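(* Let $\mu:Y\to\mathbb{R}^+$ be log-supermodular and $0\le s\le t$. For $k:Y\to\mathbb{R}^+$ let $$F(k;z)=\sum_{\lambda\in Y} k(\lambda)\,\mu(\lambda)\,(f_\lambda)^t\,\frac{z^{|\lambda|}}{(|\lambda|!)^s}\in\mathbb{R}^+[[z]].$$ If $g,h:Y\to\mathbb{R}^+$ are comonotone, then $F(g;z)\cdot F(h;z)\ll F(1;z)\cdot F(gh;z)$. If $g,h$ are countermonotone, the reverse inequality $F(1;z)\cdot F(gh;z)\ll F(g;z)\cdot F(h;z)$ holds.
   Context: Young's lattice $Y$ is the set of all integer partitions ordered by inclusion of Ferrers diagrams, with $\lambda\vee\sigma=(\max(\lambda_i,\sigma_i))_i$, $\lambda\wedge\sigma=(\min(\lambda_i,\sigma_i))_i$. $|\lambda|=\sum\lambda_i$ and $f_\lambda$ is the number of standard Young tableaux of shape $\lambda$. $\mu$ is log-supermodular if $\mu(\lambda)\mu(\sigma)\le\mu(\lambda\wedge\sigma)\mu(\lambda\vee\sigma)$ for all $\lambda,\sigma$. A function is increasing (resp. decreasing) if $\lambda\le\sigma$ implies $g(\lambda)\le g(\sigma)$ (resp. $\ge$); comonotone means both increasing or both decreasing, countermonotone means one increasing and one decreasing. For formal power series, $G(z)\ll H(z)$ means $H(z)-G(z)$ has all coefficients nonnegative. $1$ is the constant function, $gh$ the pointwise product. *)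

theory Defs
  imports Complex_Main "HOL-Library.FuncSet" "HOL-Computational_Algebra.Formal_Power_Series"
begin

text \<open>
  A partition is its weakly decreasing, eventually zero sequence of parts. Indices start at 0, so
  \<^term>\<open>part l i\<close> is usually written $\lambda_{i+1}$.
\<close>

typedef partition = "{l :: nat \<Rightarrow> nat. antimono l \<and> finite {i. l i \<noteq> 0}}"
  morphisms part Partition
  by (rule exI[of _ "\<lambda>_. 0"]) (auto simp: monotone_def)

setup_lifting type_definition_partition

definition ferrers :: "partition \<Rightarrow> (nat \<times> nat) set" where
  "ferrers l = {(i, j). j < part l i}"

lemma ferrers_subset_iff: "ferrers l \<subseteq> ferrers m \<longleftrightarrow> (\<forall>i. part l i \<le> part m i)"
proof
  assume *: "ferrers l \<subseteq> ferrers m"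
  show "\<forall>i. part l i \<le> part m i"
  proof (rule allI, rule ccontr)
    fix i assume "\<not> part l i \<le> part m i"
    then have "(i, part m i) \<in> ferrers l" by (simp add: ferrers_def)
    with * have "(i, part m i) \<in> ferrers m" by blast
    then show False by (simp add: ferrers_def)
  qed
next
  assume "\<forall>i. part l i \<le> part m i"
  then show "ferrers l \<subseteq> ferrers m"
    by (auto simp: ferrers_def intro: less_le_trans)
qed

instantiation partition :: distrib_lattice
begin

definition less_eq_partition :: "partition \<Rightarrow> partition \<Rightarrow> bool" where
  "l \<le> m \<longleftrightarrow> ferrers l \<subseteq> ferrers m"

definition less_partition :: "partition \<Rightarrow> partition \<Rightarrow> bool" where
  "l < m \<longleftrightarrow> l \<le> m \<and> \<not> m \<le> (l :: partition)"

lift_definition sup_partition :: "partition \<Rightarrow> partition \<Rightarrow> partition"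
  is "\<lambda>l m i. max (l i) (m i)"
proof -
  fix l m :: "nat \<Rightarrow> nat"
  assume l: "antimono l \<and> finite {i. l i \<noteq> 0}" and m: "antimono m \<and> finite {i. m i \<noteq> 0}"
  have "finite {i. max (l i) (m i) \<noteq> 0}"
    by (rule finite_subset[of _ "{i. l i \<noteq> 0} \<union> {i. m i \<noteq> 0}"]) (use l m in auto)
  moreover have "antimono (\<lambda>i. max (l i) (m i))"
    using l m by (intro antimonoI max.mono) (auto dest: antimonoD)
  ultimately show "antimono (\<lambda>i. max (l i) (m i)) \<and> finite {i. max (l i) (m i) \<noteq> 0}" by blast
qed

lift_definition inf_partition :: "partition \<Rightarrow> partition \<Rightarrow> partition"
  is "\<lambda>l m i. min (l i) (m i)"
proof -
  fix l m :: "nat \<Rightarrow> nat"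
  assume l: "antimono l \<and> finite {i. l i \<noteq> 0}" and m: "antimono m \<and> finite {i. m i \<noteq> 0}"
  have "finite {i. min (l i) (m i) \<noteq> 0}"
    by (rule finite_subset[of _ "{i. l i \<noteq> 0}"]) (use l in auto)
  moreover have "antimono (\<lambda>i. min (l i) (m i))"
    using l m by (intro antimonoI min.mono) (auto dest: antimonoD)
  ultimately show "antimono (\<lambda>i. min (l i) (m i)) \<and> finite {i. min (l i) (m i) \<noteq> 0}" by blast
qed

instance
proof
  fix x y z :: partition
  show "x < y \<longleftrightarrow> x \<le> y \<and> \<not> y \<le> x" by (rule less_partition_def)
  show "x \<le> x" by (simp add: less_eq_partition_def)
  show "x \<le> y \<Longrightarrow> y \<le> z \<Longrightarrow> x \<le> z" by (auto simp: less_eq_partition_def)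
  show "x \<le> y \<Longrightarrow> y \<le> x \<Longrightarrow> x = y"
    by (auto simp: less_eq_partition_def ferrers_subset_iff part_inject[symmetric] fun_eq_iff
        intro: antisym)
  show "inf x y \<le> x" "inf x y \<le> y" "x \<le> y \<Longrightarrow> x \<le> z \<Longrightarrow> x \<le> inf y z"
    "x \<le> sup x y" "y \<le> sup x y" "y \<le> x \<Longrightarrow> z \<le> x \<Longrightarrow> sup y z \<le> x"
    by (simp_all add: less_eq_partition_def ferrers_subset_iff inf_partition.rep_eq sup_partition.rep_eq)
  show "sup x (inf y z) = inf (sup x y) (sup x z)"
    by (simp add: part_inject[symmetric] fun_eq_iff inf_partition.rep_eq sup_partition.rep_eq
        max_min_distrib2)
qed

end

definition weight :: "partition \<Rightarrow> nat" where
  "weight l = (\<Sum>i | part l i \<noteq> 0. part l i)"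

text \<open>Tableaux are extensional outside the Ferrers diagram, so that each filling is counted once.\<close>

definition standard_tableaux :: "partition \<Rightarrow> (nat \<times> nat \<Rightarrow> nat) set" where
  "standard_tableaux l = {T. T \<in> extensional (ferrers l) \<and> bij_betw T (ferrers l) {1..weight l} \<and>
     (\<forall>i j. (i, j) \<in> ferrers l \<and> (i, Suc j) \<in> ferrers l \<longrightarrow> T (i, j) < T (i, Suc j)) \<and>
     (\<forall>i j. (i, j) \<in> ferrers l \<and> (Suc i, j) \<in> ferrers l \<longrightarrow> T (i, j) < T (Suc i, j))}"

definition num_syt :: "partition \<Rightarrow> nat" where
  "num_syt l = card (standard_tableaux l)"

definition log_supermodular :: "('a :: lattice \<Rightarrow> real) \<Rightarrow> bool" where
  "log_supermodular \<mu> \<longleftrightarrow> (\<forall>x y. \<mu> x * \<mu> y \<le> \<mu> (inf x y) * \<mu> (sup x y))"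

definition comonotone :: "('a :: order \<Rightarrow> real) \<Rightarrow> ('a \<Rightarrow> real) \<Rightarrow> bool" where
  "comonotone g h \<longleftrightarrow> (mono g \<and> mono h) \<or> (antimono g \<and> antimono h)"

definition countermonotone :: "('a :: order \<Rightarrow> real) \<Rightarrow> ('a \<Rightarrow> real) \<Rightarrow> bool" where
  "countermonotone g h \<longleftrightarrow> (mono g \<and> antimono h) \<or> (antimono g \<and> mono h)"

definition fps_coeff_le :: "real fps \<Rightarrow> real fps \<Rightarrow> bool" (infix "\<lless>" 50) where
  "G \<lless> H \<longleftrightarrow> (\<forall>n. fps_nth (H - G) n \<ge> 0)"

lemma part_le_weight: "part l i \<le> weight l"
proof (cases "part l i = 0")
  case False
  then show ?thesis
    unfolding weight_def using part[of l] by (intro member_le_sum) auto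
qed simp

lemma part_eq_0: 
  assumes "i \<ge> weight l" shows "part l i = 0"
proof (rule ccontr)
  assume "part l i \<noteq> 0"
  then have pos: "part l j > 0" if "j \<le> i" for j
    using part[of l] that by (auto simp: monotone_def) (metis le_zero_eq not_gr_zero)
  have "Suc i = (\<Sum>j\<le>i. 1)" by simp
  also have "\<dots> \<le> (\<Sum>j\<le>i. part l j)" using pos by (intro sum_mono) (auto simp: Suc_le_eq)
  also have "\<dots> \<le> weight l"
    unfolding weight_def using part[of l] pos by (intro sum_mono2) force+
  finally show False using assms by simp
qed

text \<open>
  The sums over \<^prop>\<open>weight l = n\<close> in \<open>F\<close> below are finite, and \<^term>\<open>num_syt l\<close> is positive
  (so its real powers, including the zeroth, are the usual ones).
\<close>

lemma finite_weight_eq: "finite {l. weight l = n}"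
proof (rule finite_imageD)
  let ?A = "{f :: nat \<Rightarrow> nat. \<forall>i. (i \<in> {..<n} \<longrightarrow> f i \<in> {..n}) \<and> (i \<notin> {..<n} \<longrightarrow> f i = 0)}"
  have "finite ?A" by (rule finite_set_of_finite_funs) auto
  moreover have "part ` {l. weight l = n} \<subseteq> ?A"
    using part_le_weight part_eq_0 by (auto simp: not_less)
  ultimately show "finite (part ` {l. weight l = n})" by (rule finite_subset[rotated])
  show "inj_on part {l. weight l = n}" by (simp add: inj_on_def part_inject)
qed

lemma finite_ferrers: "finite (ferrers l)"
  by (rule finite_subset[of _ "{..<weight l} \<times> {..<weight l}"])
    (use part_le_weight part_eq_0 in \<open>auto simp: ferrers_def intro: less_le_trans\<close>,
     metis less_nat_zero_code not_less part_eq_0)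

lemma card_ferrers: "card (ferrers l) = weight l"
proof -
  have "ferrers l = (SIGMA i:{i. part l i \<noteq> 0}. {..<part l i})" by (auto simp: ferrers_def)
  then show ?thesis using part[of l] by (simp add: weight_def)
qed

lemma finite_standard_tableaux: "finite (standard_tableaux l)"
  by (rule finite_subset[OF _ finite_PiE[OF finite_ferrers, of l "\<lambda>_. {1..weight l}"]])
    (auto simp: standard_tableaux_def PiE_def dest: bij_betwE)

lemma num_syt_pos: "num_syt l > 0"
proof -
  define S where "S i = (\<Sum>k<i. part l k)" for i
  define T where "T = restrict (\<lambda>(i, j). Suc (S i + j)) (ferrers l)"
  have S_mono: "S i \<le> S j" if "i \<le> j" for i j
    unfolding S_def using that by (intro sum_mono2) auto
  have S_next: "S i + part l i \<le> S j" if "i < j" for i j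
    using S_mono[of "Suc i" j] that by (simp add: S_def)
  have S_le: "S i \<le> weight l" for i
  proof -
    have "S i = (\<Sum>k\<in>{..<i} \<inter> {k. part l k \<noteq> 0}. part l k)"
      unfolding S_def by (intro sum.mono_neutral_right) auto
    also have "\<dots> \<le> weight l"
      unfolding weight_def using part[of l] by (intro sum_mono2) auto
    finally show ?thesis .
  qed
  have inj: "inj_on T (ferrers l)"
  proof (rule inj_onI, clarify)
    fix i j i' j'
    assume a: "(i, j) \<in> ferrers l" "(i', j') \<in> ferrers l" "T (i, j) = T (i', j')"
    then have "S i + j = S i' + j'" "j < part l i" "j' < part l i'"
      by (auto simp: T_def ferrers_def)
    with S_next[of i i'] S_next[of i' i] show "i = i' \<and> j = j'"
      by (cases i i' rule: linorder_cases) auto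
  qed
  have "T ` ferrers l \<subseteq> {1..weight l}"
  proof clarify
    fix i j assume a: "(i, j) \<in> ferrers l"
    then have "Suc (S i + j) \<le> S (Suc i)" by (simp add: ferrers_def S_def)
    with S_le[of "Suc i"] a show "T (i, j) \<in> {1..weight l}" by (simp add: T_def)
  qed
  then have "T ` ferrers l = {1..weight l}"
    by (rule card_subset_eq[rotated]) (simp_all add: card_image[OF inj] card_ferrers)
  with inj have "bij_betw T (ferrers l) {1..weight l}" by (simp add: bij_betw_def)
  moreover have "T (i, j) < T (Suc i, j)" if "(i, j) \<in> ferrers l" "(Suc i, j) \<in> ferrers l" for i j
    using that by (auto simp: T_def ferrers_def S_def)
  ultimately have "T \<in> standard_tableaux l"
    by (auto simp: standard_tableaux_def T_def)
  then show ?thesis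
    unfolding num_syt_def using finite_standard_tableaux[of l] by (auto simp: card_gt_0_iff)
qed

definition F :: "(partition \<Rightarrow> real) \<Rightarrow> real \<Rightarrow> real \<Rightarrow> (partition \<Rightarrow> real) \<Rightarrow> real fps" where
  "F \<mu> s t k = Abs_fps (\<lambda>n. \<Sum>l | weight l = n.
     k l * \<mu> l * (real (num_syt l) powr t) / (fact (weight l) powr s))"

end

theory Submission
  imports Defs "HOL-Library.Infinite_Set"
begin

text \<open>
  Put $w(\lambda) = \mu(\lambda) f_\lambda^t / (|\lambda|!)^s$. For pairs $(x, y)$ of fixed total weight $n$,
  symmetrising under $x \leftrightarrow y$ shows that twice the coefficient of $z^n$ in
  $F(1) F(gh) - F(g) F(h)$ is $\sum w(x) w(y) (g(x) - g(y)) (h(x) - h(y))$. Split this sum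
  according to $(x \wedge y, x \vee y)$. Each fibre consists of the complementary pairs of an interval,
  a Boolean lattice ordered by $x$, on which $w(x) w(y)$ is log-supermodular and, for increasing $g$ and $h$,
  both $g(x) - g(y)$ and $h(x) - h(y)$ are increasing with mean zero; so the FKG inequality applies.

  That $w$ is log-supermodular reduces to the same property of $f_\lambda / |\lambda|!$. This is the limit of
  $N_m(\lambda) / (m+1)^{|\lambda|}$, where $N_m(\lambda)$ counts the plane partitions supported in $\lambda$
  with entries at most $m$, and the four functions theorem, applied to the indicator functions of the
  relevant sets of plane partitions, gives
  $N_m(\lambda) N_m(\sigma) \le N_m(\lambda \wedge \sigma) N_m(\lambda \vee \sigma)$.
\<close>

section \<open>The four functions theorem and the FKG inequality\<close>

text \<open>This is the inequality for a one-element ground set: unprimed letters are values at the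
  empty set, primed ones at the full set. The outer products compare directly. The middle ones
  satisfy \<open>u\<close> \<le> \<open>p\<close>, \<open>v\<close> \<le> \<open>p\<close> and
  \<open>u * v\<close> \<le> \<open>p * q\<close>, so \<open>(p - u) * (p - v)\<close> \<ge> 0 gives
  \<open>u + v\<close> \<le> \<open>p + q\<close> after division by \<open>p\<close>; the case
  \<open>p = 0\<close> is trivial.\<close>

lemma four_functions_two_point:
  fixes a b c d a' b' c' d' :: real
  assumes nonneg: "0 \<le> a" "0 \<le> a'" "0 \<le> b" "0 \<le> b'" "0 \<le> c" "0 \<le> c'" "0 \<le> d" "0 \<le> d'"
    and le: "a * b \<le> c * d" "a * b' \<le> c * d'" "a' * b \<le> c * d'" "a' * b' \<le> c' * d'"
  shows "(a + a') * (b + b') \<le> (c + c') * (d + d')"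
proof -
  define u v p q where "u = a * b'" and "v = a' * b" and "p = c * d'" and "q = c' * d"
  have "u * v = (a * b) * (a' * b')" by (simp add: u_def v_def)
  also have "\<dots> \<le> (c * d) * (c' * d')"
    using nonneg by (intro mult_mono[OF le(1,4)]) simp_all
  also have "\<dots> = p * q" by (simp add: p_def q_def)
  finally have uv: "u * v \<le> p * q" .
  have up: "u \<le> p" "v \<le> p" using le by (simp_all add: u_def v_def p_def)
  have pos: "0 \<le> u" "0 \<le> v" "0 \<le> p" "0 \<le> q"
    using nonneg by (simp_all add: u_def v_def p_def q_def)
  have "u + v \<le> p + q"
  proof (cases "p = 0")
    case False
    have "0 \<le> (p - u) * (p - v)" using up by simp
    then have "p * (u + v) \<le> p * (p + q)" using uv by (simp add: algebra_simps)
    then show ?thesis using False pos by simp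
  qed (use up pos in simp)
  then show ?thesis using le by (simp add: u_def v_def p_def q_def algebra_simps)
qed

text \<open>Induction on the ground set: adding the values at \<open>A\<close> and
  \<open>insert a A\<close> turns each function on the larger power set into one on
  \<open>Pow X\<close> with the same total, and the two-point inequality shows that the hypothesis
  survives.\<close>

theorem four_functions_Pow:
  fixes \<alpha> \<beta> \<gamma> \<delta> :: "'a set \<Rightarrow> real"
  assumes "finite X"
    and "\<And>A. A \<subseteq> X \<Longrightarrow> 0 \<le> \<alpha> A" "\<And>A. A \<subseteq> X \<Longrightarrow> 0 \<le> \<beta> A"
      "\<And>A. A \<subseteq> X \<Longrightarrow> 0 \<le> \<gamma> A" "\<And>A. A \<subseteq> X \<Longrightarrow> 0 \<le> \<delta> A"
    and "\<And>A B. A \<subseteq> X \<Longrightarrow> B \<subseteq> X \<Longrightarrow> \<alpha> A * \<beta> B \<le> \<gamma> (A \<inter> B) * \<delta> (A \<union> B)"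
  shows "sum \<alpha> (Pow X) * sum \<beta> (Pow X) \<le> sum \<gamma> (Pow X) * sum \<delta> (Pow X)"
  using assms
proof (induction X arbitrary: \<alpha> \<beta> \<gamma> \<delta> rule: finite_induct)
  case empty
  then show ?case by (simp add: empty.prems(5)[of "{}" "{}", simplified])
next
  case (insert a X)
  have split: "sum \<phi> (Pow (insert a X)) = (\<Sum>A\<in>Pow X. \<phi> A + \<phi> (insert a A))"
    for \<phi> :: "'a set \<Rightarrow> real"
  proof -
    have inj: "inj_on (insert a) (Pow X)"
      using insert.hyps(2) by (auto simp: inj_on_def)
    have "sum \<phi> (Pow (insert a X)) = sum \<phi> (Pow X) + sum \<phi> (insert a ` Pow X)"
      unfolding Pow_insert using insert.hyps by (intro sum.union_disjoint) auto
    then show ?thesis by (simp add: sum.reindex[OF inj] sum.distrib)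
  qed
  show ?case
    unfolding split
  proof (rule insert.IH)
    fix A B assume AB: "A \<subseteq> X" "B \<subseteq> X"
    then have "a \<notin> A" "a \<notin> B" using insert.hyps by auto
    then have meet: "A \<inter> insert a B = A \<inter> B" "insert a A \<inter> B = A \<inter> B"
      "insert a A \<inter> insert a B = insert a (A \<inter> B)" by auto
    have join: "A \<union> insert a B = insert a (A \<union> B)" "insert a A \<union> B = insert a (A \<union> B)"
      "insert a A \<union> insert a B = insert a (A \<union> B)" by auto
    have sub: "A \<subseteq> insert a X" "insert a A \<subseteq> insert a X" "B \<subseteq> insert a X" "insert a B \<subseteq> insert a X"
      "A \<inter> B \<subseteq> insert a X" "insert a (A \<inter> B) \<subseteq> insert a X"
      "A \<union> B \<subseteq> insert a X" "insert a (A \<union> B) \<subseteq> insert a X"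
      using AB by auto
    show "(\<alpha> A + \<alpha> (insert a A)) * (\<beta> B + \<beta> (insert a B))
        \<le> (\<gamma> (A \<inter> B) + \<gamma> (insert a (A \<inter> B))) * (\<delta> (A \<union> B) + \<delta> (insert a (A \<union> B)))"
    proof (rule four_functions_two_point)
      show "\<alpha> A * \<beta> B \<le> \<gamma> (A \<inter> B) * \<delta> (A \<union> B)"
        using insert.prems(5)[OF sub(1,3)] .
      show "\<alpha> A * \<beta> (insert a B) \<le> \<gamma> (A \<inter> B) * \<delta> (insert a (A \<union> B))"
        using insert.prems(5)[OF sub(1,4)] unfolding meet join .
      show "\<alpha> (insert a A) * \<beta> B \<le> \<gamma> (A \<inter> B) * \<delta> (insert a (A \<union> B))"
        using insert.prems(5)[OF sub(2,3)] unfolding meet join .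
      show "\<alpha> (insert a A) * \<beta> (insert a B) \<le> \<gamma> (insert a (A \<inter> B)) * \<delta> (insert a (A \<union> B))"
        using insert.prems(5)[OF sub(2,4)] unfolding meet join .
    qed (use sub in \<open>simp_all add: insert.prems(1-4)\<close>)
  qed (simp_all add: insert.prems(1-4) subset_insertI2 insert_mono)
qed

text \<open>A finite distributive lattice is presented by its embedding \<open>e\<close> into a lattice of sets.\<close>

theorem four_functions:
  fixes \<alpha> \<beta> \<gamma> \<delta> :: "'a \<Rightarrow> real" and e :: "'a \<Rightarrow> 'b set"
  assumes S: "finite S" "inj_on e S" "\<And>x. x \<in> S \<Longrightarrow> finite (e x)"
    and meet: "\<And>x y. x \<in> S \<Longrightarrow> y \<in> S \<Longrightarrow> meet x y \<in> S \<and> e (meet x y) = e x \<inter> e y"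
    and join: "\<And>x y. x \<in> S \<Longrightarrow> y \<in> S \<Longrightarrow> join x y \<in> S \<and> e (join x y) = e x \<union> e y"
    and nonneg: "\<And>x. x \<in> S \<Longrightarrow> 0 \<le> \<alpha> x" "\<And>x. x \<in> S \<Longrightarrow> 0 \<le> \<beta> x"
      "\<And>x. x \<in> S \<Longrightarrow> 0 \<le> \<gamma> x" "\<And>x. x \<in> S \<Longrightarrow> 0 \<le> \<delta> x"
    and le: "\<And>x y. x \<in> S \<Longrightarrow> y \<in> S \<Longrightarrow> \<alpha> x * \<beta> y \<le> \<gamma> (meet x y) * \<delta> (join x y)"
  shows "sum \<alpha> S * sum \<beta> S \<le> sum \<gamma> S * sum \<delta> S"
proof -
  define X where "X = (\<Union>x\<in>S. e x)"
  \<comment> \<open>Extension by 0 off the image of \<open>e\<close> leaves the sums unchanged, and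
    for sets outside the image the left side of the hypothesis vanishes.\<close>
  define ext where "ext \<phi> A = (if A \<in> e ` S then \<phi> (inv_into S e A) else 0)"
    for \<phi> :: "'a \<Rightarrow> real" and A
  have ext_e: "ext \<phi> (e x) = \<phi> x" if "x \<in> S" for \<phi> x
    using that S(2) by (simp add: ext_def)
  have ext_0: "ext \<phi> A = 0" if "A \<notin> e ` S" for \<phi> A
    using that by (simp add: ext_def)
  have fin: "finite X" using S by (simp add: X_def)
  have sum_ext: "sum (ext \<phi>) (Pow X) = sum \<phi> S" for \<phi>
  proof -
    have "sum (ext \<phi>) (Pow X) = sum (ext \<phi>) (e ` S)"
      using fin by (intro sum.mono_neutral_right) (auto simp: X_def ext_0)
    also have "\<dots> = sum \<phi> S"
      unfolding sum.reindex[OF S(2)] by (rule sum.cong) (auto simp: ext_e)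
    finally show ?thesis .
  qed
  have pos: "0 \<le> ext \<phi> A" if "\<And>x. x \<in> S \<Longrightarrow> 0 \<le> \<phi> x" for \<phi> A
    using that by (cases "A \<in> e ` S") (auto simp: ext_e ext_0)
  have "ext \<alpha> A * ext \<beta> B \<le> ext \<gamma> (A \<inter> B) * ext \<delta> (A \<union> B)" for A B
  proof (cases "A \<in> e ` S \<and> B \<in> e ` S")
    case True
    then obtain x y where xy: "x \<in> S" "y \<in> S" "A = e x" "B = e y" by blast
    have "A \<inter> B = e (meet x y)" "A \<union> B = e (join x y)"
      using meet[of x y] join[of x y] xy by auto
    then show ?thesis
      using xy meet[of x y] join[of x y] le[of x y] by (metis ext_e)
  next
    case False
    then show ?thesis using nonneg by (auto simp: ext_0 intro!: mult_nonneg_nonneg pos)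
  qed
  then have "sum (ext \<alpha>) (Pow X) * sum (ext \<beta>) (Pow X) \<le> sum (ext \<gamma>) (Pow X) * sum (ext \<delta>) (Pow X)"
    using nonneg by (intro four_functions_Pow fin pos)
  then show ?thesis by (simp add: sum_ext)
qed

text \<open>The four functions theorem is applied to \<open>g\<close> and \<open>h\<close> after
  shifting both by constants that make them nonnegative; the claim itself is invariant under such
  shifts.\<close>

theorem fkg:
  fixes W g h :: "'a \<Rightarrow> real" and e :: "'a \<Rightarrow> 'b set"
  assumes S: "finite S" "inj_on e S" "\<And>x. x \<in> S \<Longrightarrow> finite (e x)"
    and meet: "\<And>x y. x \<in> S \<Longrightarrow> y \<in> S \<Longrightarrow> meet x y \<in> S \<and> e (meet x y) = e x \<inter> e y"
    and join: "\<And>x y. x \<in> S \<Longrightarrow> y \<in> S \<Longrightarrow> join x y \<in> S \<and> e (join x y) = e x \<union> e y"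
    and W: "\<And>x. x \<in> S \<Longrightarrow> 0 \<le> W x"
      "\<And>x y. x \<in> S \<Longrightarrow> y \<in> S \<Longrightarrow> W x * W y \<le> W (meet x y) * W (join x y)"
    and g: "\<And>x y. x \<in> S \<Longrightarrow> y \<in> S \<Longrightarrow> e x \<subseteq> e y \<Longrightarrow> g x \<le> g y"
    and h: "\<And>x y. x \<in> S \<Longrightarrow> y \<in> S \<Longrightarrow> e x \<subseteq> e y \<Longrightarrow> h x \<le> h y"
  shows "(\<Sum>x\<in>S. W x * g x) * (\<Sum>x\<in>S. W x * h x) \<le> sum W S * (\<Sum>x\<in>S. W x * (g x * h x))"
proof -
  \<comment> \<open>These constants dominate the absolute values of \<open>g\<close> and
    \<open>h\<close> on \<open>S\<close>.\<close>
  define C D where "C = (\<Sum>x\<in>S. \<bar>g x\<bar>)" and "D = (\<Sum>x\<in>S. \<bar>h x\<bar>)"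
  have pos: "0 \<le> g x + C" "0 \<le> h x + D" if "x \<in> S" for x
    using member_le_sum[of x S "\<lambda>x. \<bar>g x\<bar>"] member_le_sum[of x S "\<lambda>x. \<bar>h x\<bar>"] that S(1)
    by (auto simp: C_def D_def)
  have mult: "W x * (g x + C) * (W y * (h y + D))
      \<le> W (meet x y) * (W (join x y) * ((g (join x y) + C) * (h (join x y) + D)))"
    if xy: "x \<in> S" "y \<in> S" for x y
  proof -
    define j where "j = join x y"
    have j: "j \<in> S" "e x \<subseteq> e j" "e y \<subseteq> e j" using join[OF xy] by (auto simp: j_def)
    \<comment> \<open>Monotonicity moves both factors up to the join, where \<delta> is
      evaluated.\<close>
    have gh: "(g x + C) * (h y + D) \<le> (g j + C) * (h j + D)"
    proof (rule mult_mono)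
      show "g x + C \<le> g j + C" using xy j by (simp add: g)
      show "h y + D \<le> h j + D" using xy j by (simp add: h)
    qed (use xy j pos in auto)
    have "W x * W y * ((g x + C) * (h y + D)) \<le> W (meet x y) * W j * ((g j + C) * (h j + D))"
    proof (rule mult_mono[OF _ gh])
      show "W x * W y \<le> W (meet x y) * W j" using W(2)[OF xy] by (simp add: j_def)
      show "0 \<le> W (meet x y) * W j" "0 \<le> (g x + C) * (h y + D)"
        using xy j meet[OF xy] pos W(1) by simp_all
    qed
    then show ?thesis by (simp add: j_def mult_ac)
  qed
  have "(\<Sum>x\<in>S. W x * (g x + C)) * (\<Sum>x\<in>S. W x * (h x + D))
      \<le> sum W S * (\<Sum>x\<in>S. W x * ((g x + C) * (h x + D)))"
    by (rule four_functions[where \<alpha> = "\<lambda>x. W x * (g x + C)" and \<beta> = "\<lambda>x. W x * (h x + D)"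
        and \<gamma> = W and \<delta> = "\<lambda>x. W x * ((g x + C) * (h x + D))", OF S meet join])
      (simp_all add: W(1) pos mult)
  moreover have "(\<Sum>x\<in>S. W x * (g x + C)) = (\<Sum>x\<in>S. W x * g x) + C * sum W S"
    by (simp add: sum_distrib_left sum.distrib algebra_simps)
  moreover have "(\<Sum>x\<in>S. W x * (h x + D)) = (\<Sum>x\<in>S. W x * h x) + D * sum W S"
    by (simp add: sum_distrib_left sum.distrib algebra_simps)
  moreover have "(\<Sum>x\<in>S. W x * ((g x + C) * (h x + D))) = (\<Sum>x\<in>S. W x * (g x * h x))
      + D * (\<Sum>x\<in>S. W x * g x) + C * (\<Sum>x\<in>S. W x * h x) + C * D * sum W S"
    by (simp add: sum_distrib_left sum.distrib algebra_simps)
  \<comment> \<open>All terms containing \<open>C\<close> or \<open>D\<close> agree on both sides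
    and cancel.\<close>
  ultimately show ?thesis by (simp add: distrib_left distrib_right mult_ac)
qed

section \<open>Plane partitions and standard tableaux\<close>

lemma inj_ferrers: "inj ferrers"
  by (rule injI, rule order_antisym) (simp_all add: less_eq_partition_def)

lemma ferrers_inf: "ferrers (inf x y) = ferrers x \<inter> ferrers y"
  by (auto simp: ferrers_def inf_partition.rep_eq)

lemma ferrers_sup: "ferrers (sup x y) = ferrers x \<union> ferrers y"
  by (auto simp: ferrers_def sup_partition.rep_eq)

lemma ferrers_left: "(i, Suc j) \<in> ferrers l \<Longrightarrow> (i, j) \<in> ferrers l"
  by (simp add: ferrers_def)

lemma ferrers_up:
  assumes "(Suc i, j) \<in> ferrers l" shows "(i, j) \<in> ferrers l"
proof -
  have "antimono (part l)" using part[of l] by simp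
  then have "part l (Suc i) \<le> part l i" by (rule antimonoD) simp
  with assms show ?thesis by (simp add: ferrers_def)
qed

lemma weight_inf_sup: "weight (inf x y) + weight (sup x y) = weight x + weight y"
  using card_Un_Int[OF finite_ferrers finite_ferrers, of x y]
  by (simp add: card_ferrers flip: ferrers_inf ferrers_sup)

lemma weight_mono: "x \<le> y \<Longrightarrow> weight x \<le> weight y"
  using card_mono[OF finite_ferrers] by (simp add: less_eq_partition_def flip: card_ferrers)

text \<open>Entries are 0 off the diagram, not \<open>undefined\<close>, so that pointwise minima
  and maxima make sense for fillings of different shapes. Zeros inside the diagram are
  allowed.\<close>

definition plane_partitions :: "partition \<Rightarrow> nat \<Rightarrow> (nat \<times> nat \<Rightarrow> nat) set" where
  "plane_partitions l m = {T. (\<forall>c. c \<notin> ferrers l \<longrightarrow> T c = 0) \<and> (\<forall>c. T c \<le> m) \<and>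
     (\<forall>i j. T (i, Suc j) \<le> T (i, j)) \<and> (\<forall>i j. T (Suc i, j) \<le> T (i, j))}"

definition decreasing_on :: "(nat \<times> nat) set \<Rightarrow> (nat \<times> nat \<Rightarrow> nat) \<Rightarrow> bool" where
  "decreasing_on D T \<longleftrightarrow>
     (\<forall>i j. (i, j) \<in> D \<and> (i, Suc j) \<in> D \<longrightarrow> T (i, Suc j) \<le> T (i, j)) \<and>
     (\<forall>i j. (i, j) \<in> D \<and> (Suc i, j) \<in> D \<longrightarrow> T (Suc i, j) \<le> T (i, j))"

text \<open>Zero-extended fillings suit the lattice operations, extensional ones suit counting; this
  passes from one encoding to the other.\<close>

lemma bij_betw_plane_partitions:
  "bij_betw (\<lambda>T. restrict T (ferrers l)) (plane_partitions l m)
     {T \<in> ferrers l \<rightarrow>\<^sub>E {..m}. decreasing_on (ferrers l) T}"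
proof (rule bij_betw_byWitness[where f' = "\<lambda>T c. if c \<in> ferrers l then T c else 0"])
  let ?D = "ferrers l" and ?ext = "\<lambda>T c. if c \<in> ferrers l then T c else (0 :: nat)"
  show "\<forall>T\<in>plane_partitions l m. ?ext (restrict T ?D) = T"
    by (auto simp: plane_partitions_def fun_eq_iff)
  show "\<forall>T\<in>{T \<in> ?D \<rightarrow>\<^sub>E {..m}. decreasing_on ?D T}. restrict (?ext T) ?D = T"
    by (auto simp: fun_eq_iff PiE_def extensional_def)
  show "(\<lambda>T. restrict T ?D) ` plane_partitions l m \<subseteq> {T \<in> ?D \<rightarrow>\<^sub>E {..m}. decreasing_on ?D T}"
    by (auto simp: plane_partitions_def decreasing_on_def)
  show "?ext ` {T \<in> ?D \<rightarrow>\<^sub>E {..m}. decreasing_on ?D T} \<subseteq> plane_partitions l m"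
  proof clarify
    fix T assume T: "T \<in> ?D \<rightarrow>\<^sub>E {..m}" "decreasing_on ?D T"
    \<comment> \<open>Diagrams are closed under moving left and up, so a zero outside never precedes
      an entry of the diagram.\<close>
    have "?ext T (i, Suc j) \<le> ?ext T (i, j)" "?ext T (Suc i, j) \<le> ?ext T (i, j)" for i j
      using T(2) ferrers_left[of i j l] ferrers_up[of i j l] by (auto simp: decreasing_on_def)
    moreover have "?ext T c \<le> m" for c using T(1) by auto
    ultimately show "?ext T \<in> plane_partitions l m" by (simp add: plane_partitions_def)
  qed
qed

lemma finite_plane_partitions: "finite (plane_partitions l m)"
proof -
  have "finite (ferrers l \<rightarrow>\<^sub>E {..m})" by (intro finite_PiE finite_ferrers) auto
  then have "finite {T \<in> ferrers l \<rightarrow>\<^sub>E {..m}. decreasing_on (ferrers l) T}"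
    by (rule finite_subset[rotated]) blast
  then show ?thesis using bij_betw_finite[OF bij_betw_plane_partitions] by blast
qed

lemma card_plane_partitions_log_supermodular:
  "card (plane_partitions x m) * card (plane_partitions y m)
    \<le> card (plane_partitions (inf x y) m) * card (plane_partitions (sup x y) m)"
proof -
  define S where "S = plane_partitions (sup x y) m"
  define I where "I A T = (if T \<in> A then 1 else 0 :: real)" for A :: "(nat \<times> nat \<Rightarrow> nat) set" and T
  let ?P = "\<lambda>l. plane_partitions l m"
  \<comment> \<open>The solid diagram of unit boxes stacked under \<open>T\<close>; it turns minimum
    and maximum into intersection and union.\<close>
  let ?e = "\<lambda>T :: nat \<times> nat \<Rightarrow> nat. {(c, k). k < T c}"
  let ?meet = "\<lambda>T U (c :: nat \<times> nat). min (T c) (U c) :: nat"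
  let ?join = "\<lambda>T U (c :: nat \<times> nat). max (T c) (U c) :: nat"
  have meet: "?meet T U \<in> ?P (inf l l')" if "T \<in> ?P l" "U \<in> ?P l'" for T U l l'
    using that by (auto simp: plane_partitions_def ferrers_inf intro: min.coboundedI1 min.coboundedI2)
  have join: "?join T U \<in> ?P (sup l l')" if "T \<in> ?P l" "U \<in> ?P l'" for T U l l'
    using that by (auto simp: plane_partitions_def ferrers_sup intro: max.coboundedI1 max.coboundedI2)
  have "sum (I (?P x)) S * sum (I (?P y)) S \<le> sum (I (?P (inf x y))) S * sum (I (?P (sup x y))) S"
  proof (rule four_functions[where e = ?e and meet = ?meet and join = ?join])
    show "finite S" by (simp add: S_def finite_plane_partitions)
    show "inj_on ?e S"
    proof (rule inj_onI, rule ext)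
      fix T U :: "nat \<times> nat \<Rightarrow> nat" and c assume eq: "?e T = ?e U"
      have *: "k < T c \<longleftrightarrow> k < U c" for k
      proof -
        have "(c, k) \<in> ?e T \<longleftrightarrow> (c, k) \<in> ?e U" by (simp only: eq)
        then show ?thesis by simp
      qed
      show "T c = U c" using *[of "T c"] *[of "U c"] by simp
    qed
    fix T assume T: "T \<in> S"
    have "?e T = Sigma (ferrers (sup x y)) (\<lambda>c. {..<T c})"
      using T by (force simp: S_def plane_partitions_def)
    then show "finite (?e T)" by (simp add: finite_ferrers)
    fix U assume U: "U \<in> S"
    show "?meet T U \<in> S \<and> ?e (?meet T U) = ?e T \<inter> ?e U"
      using meet[of T "sup x y" U "sup x y"] T U by (auto simp: S_def)
    show "?join T U \<in> S \<and> ?e (?join T U) = ?e T \<union> ?e U"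
      using join[of T "sup x y" U "sup x y"] T U by (auto simp: S_def)
    show "I (?P x) T * I (?P y) U \<le> I (?P (inf x y)) (?meet T U) * I (?P (sup x y)) (?join T U)"
      using meet[of T x U y] join[of T x U y] by (simp add: I_def)
  qed (simp_all add: I_def)
  \<comment> \<open>All four shapes lie below \<open>sup x y\<close>, so summing an indicator over
    \<open>S\<close> counts every plane partition of that shape.\<close>
  moreover have "sum (I (?P l)) S = card (?P l)" if "l \<le> sup x y" for l
  proof -
    have "?P l \<subseteq> S"
      using that by (auto simp: S_def plane_partitions_def less_eq_partition_def)
    then show ?thesis
      by (simp add: I_def sum.If_cases finite_plane_partitions S_def Int_absorb1)
  qed
  ultimately show ?thesis
    by (simp add: le_supI1 flip: of_nat_mult)
qed

text \<open>
  Tableaux increase while plane partitions decrease, so entries are transported along the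
  order-reversing bijection from \<open>{1..weight l}\<close> to \<open>S\<close>.
\<close>

lemma card_decreasing_bij:
  assumes S: "finite S" "card S = weight l"
  shows "card {T \<in> extensional (ferrers l). bij_betw T (ferrers l) S \<and> decreasing_on (ferrers l) T}
    = num_syt l"
proof -
  define n where "n = weight l"
  obtain h where h: "bij_betw h {..<n} S" "strict_mono_on {..<n} h"
    using ex_bij_betw_strict_mono_card[OF S(1)] S(2) by (auto simp: n_def)
  \<comment> \<open>\<open>h\<close> lists \<open>S\<close> increasingly from index 0 while tableau
    entries start at 1: entry 1 goes to the largest element \<open>h (n - 1)\<close>, entry
    \<open>n\<close> to the smallest, \<open>h 0\<close>.\<close>
  define \<phi> where "\<phi> v = h (n - v)" for v
  have bij: "bij_betw \<phi> {1..n} S"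
  proof -
    have "bij_betw (\<lambda>v. n - v) {1..n} {..<n}"
      by (rule bij_betw_byWitness[where f' = "\<lambda>v. n - v"]) auto
    then have "bij_betw (h \<circ> (\<lambda>v. n - v)) {1..n} S" using h(1) by (rule bij_betw_trans)
    moreover have "\<phi> = h \<circ> (\<lambda>v. n - v)" by (simp add: \<phi>_def fun_eq_iff)
    ultimately show ?thesis by (simp only:)
  qed
  have less: "\<phi> a < \<phi> b" if "b < a" "a \<in> {1..n}" "b \<in> {1..n}" for a b
    unfolding \<phi>_def using that by (intro strict_mono_onD[OF h(2)]) auto
  define \<psi> where "\<psi> = inv_into {1..n} \<phi>"
  have inv: "bij_betw \<psi> S {1..n}" unfolding \<psi>_def using bij by (rule bij_betw_inv_into)
  have left: "\<psi> (\<phi> a) = a" if "a \<in> {1..n}" for a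
    unfolding \<psi>_def using bij that by (rule bij_betw_inv_into_left)
  have right: "\<phi> (\<psi> v) = v" if "v \<in> S" for v
    unfolding \<psi>_def using bij that by (rule bij_betw_inv_into_right)
  have inv_less: "\<psi> v < \<psi> w" if "w < v" "v \<in> S" "w \<in> S" for v w
  proof (rule ccontr)
    have "\<psi> v \<in> {1..n}" "\<psi> w \<in> {1..n}" using inv that by (auto dest: bij_betwE)
    moreover assume "\<not> \<psi> v < \<psi> w"
    ultimately have "\<phi> (\<psi> v) \<le> \<phi> (\<psi> w)"
      using less[of "\<psi> w" "\<psi> v"] by (cases "\<psi> w = \<psi> v") auto
    then show False using that by (simp add: right)
  qed
  let ?D = "ferrers l"
  let ?A = "{T \<in> extensional ?D. bij_betw T ?D S \<and> decreasing_on ?D T}"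
  have "bij_betw (\<lambda>T. restrict (\<phi> \<circ> T) ?D) (standard_tableaux l) ?A"
  proof (rule bij_betw_byWitness[where f' = "\<lambda>T. restrict (\<psi> \<circ> T) ?D"])
    show "\<forall>T\<in>standard_tableaux l. restrict (\<psi> \<circ> restrict (\<phi> \<circ> T) ?D) ?D = T"
    proof
      fix T assume T: "T \<in> standard_tableaux l"
      then have "T c \<in> {1..n}" if "c \<in> ?D" for c
        using that by (auto simp: standard_tableaux_def n_def dest: bij_betwE)
      moreover have "T \<in> extensional ?D" using T by (simp add: standard_tableaux_def)
      ultimately show "restrict (\<psi> \<circ> restrict (\<phi> \<circ> T) ?D) ?D = T"
        by (intro extensionalityI[of _ ?D]) (simp_all add: left)
    qed
    show "\<forall>T\<in>?A. restrict (\<phi> \<circ> restrict (\<psi> \<circ> T) ?D) ?D = T"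
    proof
      fix T assume T: "T \<in> ?A"
      then have "T c \<in> S" if "c \<in> ?D" for c using that by (auto dest: bij_betwE)
      then show "restrict (\<phi> \<circ> restrict (\<psi> \<circ> T) ?D) ?D = T"
        using T by (intro extensionalityI[of _ ?D]) (simp_all add: right)
    qed
    show "(\<lambda>T. restrict (\<phi> \<circ> T) ?D) ` standard_tableaux l \<subseteq> ?A"
    proof clarify
      fix T assume T: "T \<in> standard_tableaux l"
      then have bT: "bij_betw T ?D {1..n}" by (simp add: standard_tableaux_def n_def)
      then have mem: "T c \<in> {1..n}" if "c \<in> ?D" for c using that by (auto dest: bij_betwE)
      have le: "\<phi> (T c) \<le> \<phi> (T d)" if "c \<in> ?D" "d \<in> ?D" "T d < T c" for c d
        using less mem that by (simp add: less_imp_le)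
      have "decreasing_on ?D (restrict (\<phi> \<circ> T) ?D)"
        using T by (auto simp: decreasing_on_def standard_tableaux_def intro!: le)
      moreover have "bij_betw (restrict (\<phi> \<circ> T) ?D) ?D S"
        using bij_betw_trans[OF bT bij] by (simp add: bij_betw_def inj_on_def image_def)
      ultimately show "restrict (\<phi> \<circ> T) ?D \<in> extensional ?D \<and>
          bij_betw (restrict (\<phi> \<circ> T) ?D) ?D S \<and> decreasing_on ?D (restrict (\<phi> \<circ> T) ?D)" by simp
    qed
    show "(\<lambda>T. restrict (\<psi> \<circ> T) ?D) ` ?A \<subseteq> standard_tableaux l"
    proof clarify
      fix T assume T: "decreasing_on ?D T" and bT: "bij_betw T ?D S"
      \<comment> \<open>Weak decrease becomes strict increase because distinct cells carry distinct
        entries.\<close>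
      have lt: "\<psi> (T c) < \<psi> (T d)" if "c \<in> ?D" "d \<in> ?D" "T d \<le> T c" "c \<noteq> d" for c d
      proof -
        have "T c \<in> S" "T d \<in> S" "T d \<noteq> T c"
          using bT that by (auto simp: bij_betw_def inj_on_def)
        then show ?thesis using that inv_less by simp
      qed
      have "bij_betw (restrict (\<psi> \<circ> T) ?D) ?D {1..n}"
        using bij_betw_trans[OF bT inv] by (simp add: bij_betw_def inj_on_def image_def)
      then show "restrict (\<psi> \<circ> T) ?D \<in> standard_tableaux l"
        using T by (auto simp: standard_tableaux_def decreasing_on_def n_def intro!: lt)
    qed
  qed
  then show ?thesis by (simp add: num_syt_def bij_betw_same_card)
qed

text \<open>Such a filling amounts to its set of values, a subset of \<open>{..m}\<close> of size
  \<open>weight l\<close>, together with a standard tableau obtained by relabelling these values in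
  reverse order.\<close>

lemma card_decreasing_inj:
  "card {T \<in> ferrers l \<rightarrow>\<^sub>E {..m}. decreasing_on (ferrers l) T \<and> inj_on T (ferrers l)}
    = (Suc m choose weight l) * num_syt l"
proof -
  let ?D = "ferrers l"
  let ?A = "\<lambda>S. {T \<in> extensional ?D. bij_betw T ?D S \<and> decreasing_on ?D T}"
  let ?I = "{S. S \<subseteq> {..m} \<and> card S = weight l}"
  have "{T \<in> ?D \<rightarrow>\<^sub>E {..m}. decreasing_on ?D T \<and> inj_on T ?D} = (\<Union>S\<in>?I. ?A S)"
    by (auto simp: bij_betw_def card_image card_ferrers PiE_def)
  also have "card \<dots> = (\<Sum>S\<in>?I. card (?A S))"
  proof (rule card_UN_disjoint)
    show "\<forall>S\<in>?I. finite (?A S)"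
    proof
      fix S assume "S \<in> ?I"
      then have "finite (?D \<rightarrow>\<^sub>E S)" by (auto intro: finite_PiE finite_ferrers finite_subset)
      then show "finite (?A S)"
        by (rule finite_subset[rotated]) (auto simp: PiE_def dest: bij_betwE)
    qed
  qed (auto simp: bij_betw_def)
  also have "\<dots> = (\<Sum>S\<in>?I. num_syt l)"
    by (rule sum.cong) (auto intro!: card_decreasing_bij intro: finite_subset[OF _ finite_atMost])
  finally show ?thesis by (simp add: n_subsets)
qed

section \<open>Asymptotic number of plane partitions as the bound on the entries grows\<close>

lemma binomial_over_power_tendsto:
  "(\<lambda>m. real (Suc m choose n) / real (Suc m) ^ n) \<longlonglongrightarrow> 1 / fact n"
proof -
  \<comment> \<open>With \<open>n\<close> fixed, each of the \<open>n\<close> factors of the falling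
    factorial, divided by \<open>Suc m\<close>, tends to 1.\<close>
  have "(\<lambda>m. real i / real (Suc m)) \<longlonglongrightarrow> 0" for i
    using LIMSEQ_Suc[OF lim_const_over_n[of "real i"]] by simp
  then have "(\<lambda>m. (\<Prod>i=0..<n. 1 - real i / real (Suc m)) / fact n) \<longlonglongrightarrow> (\<Prod>i=0..<n. 1 - 0) / fact n"
    by (intro tendsto_intros) auto
  moreover have "real (Suc m choose n) / real (Suc m) ^ n
      = (\<Prod>i=0..<n. 1 - real i / real (Suc m)) / fact n" for m
  proof -
    have "(\<Prod>i=0..<n. 1 - real i / real (Suc m)) = (\<Prod>i=0..<n. (real (Suc m) - real i) / real (Suc m))"
      by (rule prod.cong) (auto simp: field_simps)
    then show ?thesis
      by (simp only: binomial_gbinomial gbinomial_prod_rev prod_dividef) (simp add: field_simps)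
  qed
  ultimately show ?thesis by simp
qed

lemma card_inj_PiE:
  assumes "finite D" "card D \<le> Suc m"
  shows "card {T \<in> D \<rightarrow>\<^sub>E {..m}. inj_on T D} = fact (card D) * (Suc m choose card D)"
proof -
  \<comment> \<open>The bound on \<open>card D\<close> keeps the natural-number subtraction from
    truncating.\<close>
  have "real (\<Prod>i=0..<card D. Suc m - i) = (\<Prod>i=0..<card D. real (Suc m) - real i)"
    using assms(2) by (simp add: of_nat_diff)
  also have "\<dots> = real (fact (card D) * (Suc m choose card D))"
    by (simp only: of_nat_mult of_nat_fact binomial_gbinomial gbinomial_mult_fact)
  finally show ?thesis
    using card_inj_on_subset_funcset[of D "{..m}" D] assms(1) by (simp only: of_nat_eq_iff) simp
qed

text \<open>
  The upper bound counts all non-injective fillings, not only the decreasing ones; there are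
  too few of them to matter in the limit.
\<close>

lemma plane_partitions_bounds:
  assumes "weight l \<le> Suc m"
  shows "(Suc m choose weight l) * num_syt l \<le> card (plane_partitions l m)"
    and "card (plane_partitions l m) + fact (weight l) * (Suc m choose weight l)
      \<le> (Suc m choose weight l) * num_syt l + Suc m ^ weight l"
proof -
  let ?D = "ferrers l" and ?n = "weight l"
  let ?U = "?D \<rightarrow>\<^sub>E {..m}"
  let ?P = "{T \<in> ?U. decreasing_on ?D T}"
  have fin: "finite ?U" by (intro finite_PiE finite_ferrers) auto
  have P: "card (plane_partitions l m) = card ?P"
    by (rule bij_betw_same_card[OF bij_betw_plane_partitions])
  have split: "card ?P = card {T \<in> ?U. decreasing_on ?D T \<and> inj_on T ?D}
      + card {T \<in> ?U. decreasing_on ?D T \<and> \<not> inj_on T ?D}"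
    using fin by (subst card_Un_disjoint[symmetric]) (auto intro: arg_cong[of _ _ card])
  show "(Suc m choose ?n) * num_syt l \<le> card (plane_partitions l m)"
    by (simp add: P split card_decreasing_inj)
  \<comment> \<open>Counting all fillings and the injective ones determines the number of fillings
    with a repeated entry; the identity stays additive to avoid truncated subtraction.\<close>
  have "Suc m ^ ?n = card ?U" by (simp add: card_funcsetE finite_ferrers card_ferrers)
  also have "\<dots> = card {T \<in> ?U. inj_on T ?D} + card {T \<in> ?U. \<not> inj_on T ?D}"
    using fin by (subst card_Un_disjoint[symmetric]) (auto intro: arg_cong[of _ _ card])
  also have "card {T \<in> ?U. inj_on T ?D} = fact ?n * (Suc m choose ?n)"
    using card_inj_PiE[OF finite_ferrers, of l m] assms by (simp only: card_ferrers)
  finally have "Suc m ^ ?n = fact ?n * (Suc m choose ?n) + card {T \<in> ?U. \<not> inj_on T ?D}" .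
  moreover have "card {T \<in> ?U. decreasing_on ?D T \<and> \<not> inj_on T ?D} \<le> card {T \<in> ?U. \<not> inj_on T ?D}"
    using fin by (intro card_mono) auto
  ultimately show "card (plane_partitions l m) + fact ?n * (Suc m choose ?n)
      \<le> (Suc m choose ?n) * num_syt l + Suc m ^ ?n"
    by (simp add: P split card_decreasing_inj)
qed

text \<open>With \<open>n = weight l\<close>, dividing the two bounds by \<open>Suc m ^ n\<close>
  leaves a gap of \<open>1 - fact n * b\<close>, where \<open>b\<close> is the normalised binomial
  coefficient with limit \<open>1 / fact n\<close>. The gap vanishes, and the lower bound has the
  stated limit.\<close>

lemma plane_partitions_tendsto:
  "(\<lambda>m. real (card (plane_partitions l m)) / real (Suc m) ^ weight l)
    \<longlonglongrightarrow> real (num_syt l) / fact (weight l)"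
proof (rule tendsto_sandwich)
  let ?n = "weight l" and ?f = "real (num_syt l)"
  let ?b = "\<lambda>m. real (Suc m choose ?n) / real (Suc m) ^ ?n"
  note lim = binomial_over_power_tendsto[of ?n]
  show "(\<lambda>m. ?b m * ?f) \<longlonglongrightarrow> ?f / fact ?n"
    using tendsto_mult_right[OF lim, of ?f] by simp
  show "(\<lambda>m. ?b m * ?f + 1 - fact ?n * ?b m) \<longlonglongrightarrow> ?f / fact ?n"
  proof -
    have "(\<lambda>m. ?b m * ?f + 1 - fact ?n * ?b m) \<longlonglongrightarrow> 1 / fact ?n * ?f + 1 - fact ?n * (1 / fact ?n)"
      by (intro tendsto_intros lim)
    then show ?thesis by simp
  qed
  show "\<forall>\<^sub>F m in sequentially. ?b m * ?f \<le> real (card (plane_partitions l m)) / real (Suc m) ^ ?n"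
    using eventually_ge_at_top[of ?n]
  proof eventually_elim
    case (elim m)
    then have "real ((Suc m choose ?n) * num_syt l) \<le> real (card (plane_partitions l m))"
      by (intro of_nat_mono plane_partitions_bounds(1)) simp
    then show ?case by (simp add: divide_right_mono del: of_nat_Suc binomial_Suc_Suc)
  qed
  show "\<forall>\<^sub>F m in sequentially. real (card (plane_partitions l m)) / real (Suc m) ^ ?n
      \<le> ?b m * ?f + 1 - fact ?n * ?b m"
    using eventually_ge_at_top[of ?n]
  proof eventually_elim
    case (elim m)
    have "real (card (plane_partitions l m) + fact ?n * (Suc m choose ?n))
        \<le> real ((Suc m choose ?n) * num_syt l + Suc m ^ ?n)"
      using elim by (intro of_nat_mono plane_partitions_bounds(2)) simp
    then have "real (card (plane_partitions l m))
        \<le> real (Suc m choose ?n) * ?f + real (Suc m) ^ ?n - fact ?n * real (Suc m choose ?n)"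
      by (simp only: of_nat_add of_nat_mult of_nat_power of_nat_fact)
    then have "real (card (plane_partitions l m)) / real (Suc m) ^ ?n
        \<le> (real (Suc m choose ?n) * ?f + real (Suc m) ^ ?n - fact ?n * real (Suc m choose ?n)) / real (Suc m) ^ ?n"
      by (rule divide_right_mono) simp
    also have "\<dots> = ?b m * ?f + 1 - fact ?n * ?b m"
      by (simp add: add_divide_distrib diff_divide_distrib del: of_nat_Suc binomial_Suc_Suc)
    finally show ?case .
  qed
qed

text \<open>The inequality for plane partitions passes to the limit: since \<open>weight\<close> is
  modular, both sides are normalised by the same power of \<open>Suc m\<close>.\<close>

theorem num_syt_over_fact_log_supermodular:
  "log_supermodular (\<lambda>l. real (num_syt l) / fact (weight l))"
  unfolding log_supermodular_def
proof (intro allI)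
  fix x y :: partition
  let ?r = "\<lambda>l m. real (card (plane_partitions l m)) / real (Suc m) ^ weight l"
  have "?r x m * ?r y m \<le> ?r (inf x y) m * ?r (sup x y) m" for m
  proof -
    have "real (card (plane_partitions x m) * card (plane_partitions y m))
        \<le> real (card (plane_partitions (inf x y) m) * card (plane_partitions (sup x y) m))"
      by (intro of_nat_mono card_plane_partitions_log_supermodular)
    then have "real (card (plane_partitions x m) * card (plane_partitions y m)) / real (Suc m) ^ (weight x + weight y)
        \<le> real (card (plane_partitions (inf x y) m) * card (plane_partitions (sup x y) m))
          / real (Suc m) ^ (weight (inf x y) + weight (sup x y))"
      unfolding weight_inf_sup by (rule divide_right_mono) simp
    then show ?thesis by (simp only: of_nat_mult power_add times_divide_times_eq)
  qed
  then show "real (num_syt x) / fact (weight x) * (real (num_syt y) / fact (weight y))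
      \<le> real (num_syt (inf x y)) / fact (weight (inf x y)) * (real (num_syt (sup x y)) / fact (weight (sup x y)))"
    by (intro LIMSEQ_le[OF tendsto_mult[OF plane_partitions_tendsto plane_partitions_tendsto]
        tendsto_mult[OF plane_partitions_tendsto plane_partitions_tendsto]]) blast
qed

section \<open>Log-supermodularity of the weights\<close>

text \<open>Log-convexity of the factorial: each increment of \<open>d\<close> multiplies the left
  side by \<open>r + d + 1\<close> and the right side by the larger
  \<open>q + d + 1\<close>.\<close>

lemma fact_mult_fact_le:
  assumes "r \<le> q"
  shows "fact (r + d) * fact q \<le> (fact r * fact (q + d) :: real)"
proof (induction d)
  case (Suc d)
  have "fact (r + Suc d) * fact q = real (Suc (r + d)) * (fact (r + d) * fact q)" by simp
  also have "\<dots> \<le> real (Suc (q + d)) * (fact r * fact (q + d))"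
    using assms by (intro mult_mono Suc.IH) simp_all
  also have "\<dots> = fact r * fact (q + Suc d)" by simp
  finally show ?case .
qed simp

lemma log_supermodular_fact_weight: "log_supermodular (\<lambda>l. fact (weight l))"
  unfolding log_supermodular_def
proof (intro allI)
  fix x y :: partition
  \<comment> \<open>Modularity of \<open>weight\<close> makes \<open>d\<close> also the difference
    between the weights of \<open>sup x y\<close> and \<open>y\<close>.\<close>
  define r d where "r = weight (inf x y)" and "d = weight x - r"
  have "r \<le> weight x" "r \<le> weight y" by (simp_all add: r_def weight_mono)
  then have "weight x = r + d" "weight (sup x y) = weight y + d"
    using weight_inf_sup[of x y] by (simp_all add: r_def d_def)
  then show "fact (weight x) * fact (weight y)
      \<le> (fact (weight (inf x y)) * fact (weight (sup x y)) :: real)"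
    using fact_mult_fact_le[OF \<open>r \<le> weight y\<close>, of d] by (simp add: r_def)
qed

lemma log_supermodular_mult:
  assumes "log_supermodular f" "log_supermodular g" "\<And>x. 0 \<le> f x" "\<And>x. 0 \<le> g x"
  shows "log_supermodular (\<lambda>x. f x * g x)"
  unfolding log_supermodular_def
proof (intro allI)
  fix x y
  have "(f x * f y) * (g x * g y) \<le> (f (inf x y) * f (sup x y)) * (g (inf x y) * g (sup x y))"
  proof (rule mult_mono)
    show "f x * f y \<le> f (inf x y) * f (sup x y)" "g x * g y \<le> g (inf x y) * g (sup x y)"
      using assms(1,2) by (simp_all add: log_supermodular_def)
  qed (simp_all add: assms(3,4))
  then show "f x * g x * (f y * g y) \<le> f (inf x y) * g (inf x y) * (f (sup x y) * g (sup x y))"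
    by (simp only: mult_ac)
qed

lemma log_supermodular_powr:
  assumes "log_supermodular f" "\<And>x. 0 \<le> f x" "0 \<le> a"
  shows "log_supermodular (\<lambda>x. f x powr a)"
  unfolding log_supermodular_def
proof (intro allI)
  fix x y
  have "(f x * f y) powr a \<le> (f (inf x y) * f (sup x y)) powr a"
    using assms by (intro powr_mono2) (simp_all add: log_supermodular_def)
  then show "f x powr a * f y powr a \<le> f (inf x y) powr a * f (sup x y) powr a"
    by (simp add: powr_mult assms(2))
qed

text \<open>Multiplying the normalised count by the log-supermodular factorial of the weight cancels
  the denominator.\<close>

lemma log_supermodular_num_syt: "log_supermodular (\<lambda>l. real (num_syt l))"
  using log_supermodular_mult[OF num_syt_over_fact_log_supermodular log_supermodular_fact_weight]
  by simp

definition F_weight :: "(partition \<Rightarrow> real) \<Rightarrow> real \<Rightarrow> real \<Rightarrow> partition \<Rightarrow> real" where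
  "F_weight \<mu> s t l = \<mu> l * real (num_syt l) powr t / fact (weight l) powr s"

text \<open>The factor \<open>(f / n!)^s * f^(t - s)\<close> replaces \<open>f^t / (n!)^s\<close>;
  the condition 0 \<le> \<open>s\<close> \<le> \<open>t\<close> makes both exponents nonnegative, so
  powers preserve log-supermodularity.\<close>

lemma log_supermodular_F_weight:
  assumes "\<And>l. 0 \<le> \<mu> l" "log_supermodular \<mu>" "0 \<le> s" "s \<le> t"
  shows "log_supermodular (F_weight \<mu> s t)"
proof -
  let ?r = "\<lambda>l. real (num_syt l) / fact (weight l)"
  have "F_weight \<mu> s t l = \<mu> l * (?r l powr s * real (num_syt l) powr (t - s))" for l
    using powr_add[of "real (num_syt l)" s "t - s"] by (simp add: F_weight_def powr_divide)
  then have "F_weight \<mu> s t = (\<lambda>l. \<mu> l * (?r l powr s * real (num_syt l) powr (t - s)))"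
    by (rule ext)
  moreover have "log_supermodular \<dots>"
    using assms by (intro log_supermodular_mult log_supermodular_powr
        num_syt_over_fact_log_supermodular log_supermodular_num_syt) simp_all
  ultimately show ?thesis by simp
qed

section \<open>Correlation over pairs of partitions\<close>

lemma finite_atMost_partition: "finite {l :: partition. l \<le> M}"
proof (rule finite_subset)
  show "{l. l \<le> M} \<subseteq> (\<Union>n\<in>{..weight M}. {l. weight l = n})" by (auto intro: weight_mono)
  show "finite (\<Union>n\<in>{..weight M}. {l. weight l = n})" by (simp add: finite_weight_eq)
qed

lemma partition_eq_iff: "x = y \<longleftrightarrow> ferrers x = ferrers y"
  by (simp add: inj_eq[OF inj_ferrers])

lemma sum_swap_invariant:
  assumes "\<And>p. p \<in> A \<Longrightarrow> prod.swap p \<in> A"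
  shows "(\<Sum>p\<in>A. f (snd p) (fst p)) = (\<Sum>p\<in>A. f (fst p) (snd p))"
  by (rule sum.reindex_bij_witness[of _ prod.swap prod.swap]) (simp_all add: assms)

text \<open>Ordered pairs of relative complements in the interval from \<open>m\<close> to
  \<open>M\<close>; by distributivity either component determines the other.\<close>

definition complementary :: "partition \<Rightarrow> partition \<Rightarrow> (partition \<times> partition) set" where
  "complementary m M = {p. inf (fst p) (snd p) = m \<and> sup (fst p) (snd p) = M}"

lemma in_complementary_iff:
  "p \<in> complementary m M \<longleftrightarrow> ferrers (fst p) \<inter> ferrers (snd p) = ferrers m
    \<and> ferrers (fst p) \<union> ferrers (snd p) = ferrers M"
  by (simp add: complementary_def partition_eq_iff ferrers_inf ferrers_sup)

lemma finite_complementary: "finite (complementary m M)"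
proof (rule finite_subset)
  show "complementary m M \<subseteq> {l. l \<le> M} \<times> {l. l \<le> M}" by (auto simp: complementary_def)
qed (simp add: finite_atMost_partition)

lemma complementary_correlation:
  fixes w g h :: "partition \<Rightarrow> real"
  assumes w: "\<And>l. 0 \<le> w l" "log_supermodular w" and gh: "mono g" "mono h"
  shows "0 \<le> (\<Sum>p\<in>complementary m M. w (fst p) * w (snd p)
    * ((g (fst p) - g (snd p)) * (h (fst p) - h (snd p))))"
proof -
  let ?B = "complementary m M"
  define W where "W p = w (fst p) * w (snd p)" for p
  define G where "G p = g (fst p) - g (snd p)" for p
  define H where "H p = h (fst p) - h (snd p)" for p
  \<comment> \<open>The second component is the complement of the first, so its order is reversed;
    this keeps meets and joins inside the fibre.\<close>
  define meet where "meet p q = (inf (fst p) (fst q), sup (snd p) (snd q))"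
    for p q :: "partition \<times> partition"
  define join where "join p q = (sup (fst p) (fst q), inf (snd p) (snd q))"
    for p q :: "partition \<times> partition"
  have W_nonneg: "0 \<le> W p" for p by (simp add: W_def w(1))
  have anti: "ferrers (snd q) \<subseteq> ferrers (snd p)"
    if "p \<in> ?B" "q \<in> ?B" "ferrers (fst p) \<subseteq> ferrers (fst q)" for p q
    using that unfolding in_complementary_iff by blast
  \<comment> \<open>Raising the first component lowers the second, and both changes increase the
    difference.\<close>
  have mono: "k (fst p) - k (snd p) \<le> k (fst q) - k (snd q)"
    if "mono k" "p \<in> ?B" "q \<in> ?B" "ferrers (fst p) \<subseteq> ferrers (fst q)"
    for k :: "partition \<Rightarrow> real" and p q
    using anti[OF that(2-4)] that(4) monoD[OF that(1), of "fst p" "fst q"]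
      monoD[OF that(1), of "snd q" "snd p"]
    by (simp add: less_eq_partition_def)
  have "(\<Sum>p\<in>?B. W p * G p) * (\<Sum>p\<in>?B. W p * H p) \<le> sum W ?B * (\<Sum>p\<in>?B. W p * (G p * H p))"
  proof (rule fkg[where e = "\<lambda>p. ferrers (fst p)" and meet = meet and join = join])
    show "inj_on (\<lambda>p. ferrers (fst p)) ?B"
      by (rule inj_onI) (simp add: prod_eq_iff partition_eq_iff anti subset_antisym)
    fix p q assume pq: "p \<in> ?B" "q \<in> ?B"
    show "meet p q \<in> ?B \<and> ferrers (fst (meet p q)) = ferrers (fst p) \<inter> ferrers (fst q)"
      using pq unfolding in_complementary_iff meet_def fst_conv snd_conv ferrers_inf ferrers_sup
      by blast
    show "join p q \<in> ?B \<and> ferrers (fst (join p q)) = ferrers (fst p) \<union> ferrers (fst q)"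
      using pq unfolding in_complementary_iff join_def fst_conv snd_conv ferrers_inf ferrers_sup
      by blast
    \<comment> \<open>Log-supermodularity is used once on the first and once on the second
      components; the reversed order only permutes the four resulting factors.\<close>
    have "(w (fst p) * w (fst q)) * (w (snd p) * w (snd q))
        \<le> (w (inf (fst p) (fst q)) * w (sup (fst p) (fst q)))
          * (w (inf (snd p) (snd q)) * w (sup (snd p) (snd q)))"
    proof (rule mult_mono)
      show "w (fst p) * w (fst q) \<le> w (inf (fst p) (fst q)) * w (sup (fst p) (fst q))"
        "w (snd p) * w (snd q) \<le> w (inf (snd p) (snd q)) * w (sup (snd p) (snd q))"
        using w(2) by (simp_all add: log_supermodular_def)
    qed (simp_all add: w(1))
    then show "W p * W q \<le> W (meet p q) * W (join p q)"
      by (simp only: W_def meet_def join_def fst_conv snd_conv mult_ac)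
    assume "ferrers (fst p) \<subseteq> ferrers (fst q)"
    then show "G p \<le> G q" "H p \<le> H q" using gh pq by (simp_all add: G_def H_def mono)
  qed (simp_all add: W_nonneg finite_complementary finite_ferrers)
  \<comment> \<open>Swapping the components preserves the fibre and \<open>W\<close> but negates the
    difference, so the left side of the FKG inequality is zero.\<close>
  moreover have "(\<Sum>p\<in>?B. W p * (k (fst p) - k (snd p))) = 0" for k :: "partition \<Rightarrow> real"
  proof -
    have "(\<Sum>p\<in>?B. w (snd p) * w (fst p) * k (snd p)) = (\<Sum>p\<in>?B. w (fst p) * w (snd p) * k (fst p))"
      by (rule sum_swap_invariant) (simp add: complementary_def inf.commute sup.commute)
    then show ?thesis by (simp add: W_def right_diff_distrib sum_subtractf mult_ac)
  qed
  ultimately have "0 \<le> sum W ?B * (\<Sum>p\<in>?B. W p * (G p * H p))"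
    by (simp add: G_def)
  \<comment> \<open>If the total weight is zero it cannot be divided out, but then every
    \<open>W p\<close> on the fibre vanishes.\<close>
  moreover have "sum W ?B = 0 \<Longrightarrow> (\<Sum>p\<in>?B. W p * (G p * H p)) = 0"
    using W_nonneg by (simp add: sum_nonneg_eq_0_iff finite_complementary)
  moreover have "0 \<le> sum W ?B" using W_nonneg by (simp add: sum_nonneg)
  ultimately have "0 \<le> (\<Sum>p\<in>?B. W p * (G p * H p))"
    by (cases "sum W ?B = 0") (simp_all add: zero_le_mult_iff)
  then show ?thesis by (simp only: W_def G_def H_def)
qed

section \<open>Coefficients of the products of the series\<close>

definition weight_pairs :: "nat \<Rightarrow> (partition \<times> partition) set" where
  "weight_pairs n = {p. weight (fst p) + weight (snd p) = n}"

lemma finite_weight_pairs: "finite (weight_pairs n)"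
proof (rule finite_subset)
  let ?L = "\<Union>k\<in>{..n}. {l. weight l = k}"
  show "weight_pairs n \<subseteq> ?L \<times> ?L" by (auto simp: weight_pairs_def)
qed (simp add: finite_weight_eq)

text \<open>Modularity of \<open>weight\<close> makes the total weight constant on each fibre, so
  \<open>weight_pairs n\<close> is a disjoint union of entire fibres, each contributing a
  nonnegative sum.\<close>

lemma weight_pairs_correlation:
  fixes w g h :: "partition \<Rightarrow> real"
  assumes "\<And>l. 0 \<le> w l" "log_supermodular w" "mono g" "mono h"
  shows "0 \<le> (\<Sum>p\<in>weight_pairs n. w (fst p) * w (snd p)
    * ((g (fst p) - g (snd p)) * (h (fst p) - h (snd p))))" (is "0 \<le> sum ?f _")
proof -
  let ?b = "\<lambda>p :: partition \<times> partition. (inf (fst p) (snd p), sup (fst p) (snd p))"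
  have fibre: "{p \<in> weight_pairs n. ?b p = q} = complementary (fst q) (snd q)"
    if "q \<in> ?b ` weight_pairs n" for q
  proof -
    have "weight (fst q) + weight (snd q) = n"
      using that by (auto simp: weight_pairs_def weight_inf_sup)
    then have "p \<in> weight_pairs n" if "?b p = q" for p
      unfolding weight_pairs_def that[symmetric] by (simp add: weight_inf_sup)
    moreover have "p \<in> complementary (fst q) (snd q) \<longleftrightarrow> ?b p = q" for p
      by (simp add: complementary_def prod_eq_iff)
    ultimately show ?thesis by blast
  qed
  have "sum ?f (weight_pairs n)
      = (\<Sum>q\<in>?b ` weight_pairs n. sum ?f {p \<in> weight_pairs n. ?b p = q})"
    by (rule sum.group[symmetric]) (simp_all add: finite_weight_pairs)
  also have "\<dots> = (\<Sum>q\<in>?b ` weight_pairs n. sum ?f (complementary (fst q) (snd q)))"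
    by (rule sum.cong) (simp_all only: fibre)
  also have "\<dots> \<ge> 0"
    by (rule sum_nonneg) (rule complementary_correlation[OF assms])
  finally show ?thesis .
qed

text \<open>The Cauchy product runs over weights \<open>i\<close> and \<open>n - i\<close>; grouping
  pairs by the weight of the first component merges its terms into a single sum.\<close>

lemma fps_nth_F_mult_F:
  "fps_nth (F \<mu> s t k * F \<mu> s t k') n = (\<Sum>p\<in>weight_pairs n.
    F_weight \<mu> s t (fst p) * F_weight \<mu> s t (snd p) * (k (fst p) * k' (snd p)))"
proof -
  let ?w = "F_weight \<mu> s t"
  let ?f = "\<lambda>p. ?w (fst p) * ?w (snd p) * (k (fst p) * k' (snd p))"
  have nth: "fps_nth (F \<mu> s t c) i = (\<Sum>l | weight l = i. c l * ?w l)" for c i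
    by (simp add: F_def F_weight_def mult.assoc)
  have "fps_nth (F \<mu> s t k * F \<mu> s t k') n
      = (\<Sum>i\<in>{0..n}. sum ?f ({l. weight l = i} \<times> {l. weight l = n - i}))"
    by (simp add: fps_mult_nth nth sum_product sum.cartesian_product case_prod_unfold mult_ac)
  also have "\<dots> = (\<Sum>i\<in>{0..n}. sum ?f {p \<in> weight_pairs n. weight (fst p) = i})"
    by (intro sum.cong refl) (auto simp: weight_pairs_def)
  also have "\<dots> = sum ?f (weight_pairs n)"
    by (rule sum.group[OF finite_weight_pairs]) (auto simp: weight_pairs_def)
  finally show ?thesis .
qed

lemma F_coefficient_difference:
  "2 * fps_nth (F \<mu> s t (\<lambda>_. 1) * F \<mu> s t (\<lambda>l. g l * h l) - F \<mu> s t g * F \<mu> s t h) n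
    = (\<Sum>p\<in>weight_pairs n. F_weight \<mu> s t (fst p) * F_weight \<mu> s t (snd p)
        * ((g (fst p) - g (snd p)) * (h (fst p) - h (snd p))))"
proof -
  let ?S = "\<lambda>f. \<Sum>p\<in>weight_pairs n. F_weight \<mu> s t (fst p) * F_weight \<mu> s t (snd p) * f (fst p) (snd p)"
  \<comment> \<open>The index set and the product of weights are symmetric, so the four sums of the
    expanded product agree in pairs; this is the source of the factor 2.\<close>
  have swap: "?S (\<lambda>x y. f y x) = ?S f" for f
    using sum_swap_invariant[of "weight_pairs n"
        "\<lambda>x y. F_weight \<mu> s t x * F_weight \<mu> s t y * f x y"]
    by (simp add: weight_pairs_def add.commute mult_ac)
  have "?S (\<lambda>x y. (g x - g y) * (h x - h y))
      = ?S (\<lambda>x y. g x * h x) + ?S (\<lambda>x y. g y * h y) - ?S (\<lambda>x y. g x * h y) - ?S (\<lambda>x y. g y * h x)"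
    by (simp add: algebra_simps sum.distrib sum_subtractf)
  also have "\<dots> = 2 * (?S (\<lambda>x y. g y * h y) - ?S (\<lambda>x y. g x * h y))"
    using swap[of "\<lambda>x y. g y * h y"] swap[of "\<lambda>x y. g x * h y"] by simp
  finally show ?thesis by (simp add: fps_nth_F_mult_F)
qed

theorem theorem6p3:
  fixes \<mu> g h :: "partition \<Rightarrow> real" and s t :: real
  assumes "\<And>l. 0 \<le> \<mu> l" and "log_supermodular \<mu>"
    and "0 \<le> s" and "s \<le> t"
    and "\<And>l. 0 \<le> g l" and "\<And>l. 0 \<le> h l"
  shows "(comonotone g h \<longrightarrow>
      F \<mu> s t g * F \<mu> s t h \<lless> F \<mu> s t (\<lambda>_. 1) * F \<mu> s t (\<lambda>l. g l * h l)) \<and>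
    (countermonotone g h \<longrightarrow>
      F \<mu> s t (\<lambda>_. 1) * F \<mu> s t (\<lambda>l. g l * h l) \<lless> F \<mu> s t g * F \<mu> s t h)"
proof -
  let ?w = "F_weight \<mu> s t"
  let ?D = "\<lambda>g h n. \<Sum>p\<in>weight_pairs n. ?w (fst p) * ?w (snd p)
    * ((g (fst p) - g (snd p)) * (h (fst p) - h (snd p)))"
  have w: "0 \<le> ?w l" for l using assms(1) by (simp add: F_weight_def)
  note nonneg = weight_pairs_correlation[OF w log_supermodular_F_weight[OF assms(1-4)]]
  \<comment> \<open>A decreasing function is replaced by its negative: negating one of
    \<open>g\<close> and \<open>h\<close> flips the sign of the sum, negating both preserves
    it.\<close>
  have neg: "mono (\<lambda>l. - k l)" if "antimono k" for k :: "partition \<Rightarrow> real"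
    using that by (simp add: monotone_def)
  have minus: "?D (\<lambda>l. - g l) (\<lambda>l. - h l) n = ?D g h n"
    "?D (\<lambda>l. - g l) h n = - ?D g h n" "?D g (\<lambda>l. - h l) n = - ?D g h n" for n
    by (simp_all add: algebra_simps flip: sum_negf)
  have "0 \<le> ?D g h n" if "comonotone g h" for n
    using that unfolding comonotone_def
  proof
    assume "mono g \<and> mono h"
    then show ?thesis by (intro nonneg) simp_all
  next
    assume "antimono g \<and> antimono h"
    then have "0 \<le> ?D (\<lambda>l. - g l) (\<lambda>l. - h l) n" by (intro nonneg neg) simp_all
    then show ?thesis unfolding minus .
  qed
  moreover have "0 \<le> - ?D g h n" if "countermonotone g h" for n
    using that unfolding countermonotone_def
  proof
    assume "mono g \<and> antimono h"
    then have "0 \<le> ?D g (\<lambda>l. - h l) n" by (intro nonneg neg) simp_all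
    then show ?thesis unfolding minus .
  next
    assume "antimono g \<and> mono h"
    then have "0 \<le> ?D (\<lambda>l. - g l) h n" by (intro nonneg neg) simp_all
    then show ?thesis unfolding minus .
  qed
  ultimately show ?thesis
    unfolding fps_coeff_le_def F_coefficient_difference[symmetric] by simp
qed

end
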